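(* Let $\alpha=\frac{1}{2}$. Then, as $n\to\infty$, \[ \|\sigma_n^{1/2}\| \sim \frac{1}{2}(\log n)^{1/2}. \]
   Context: $\Gamma$ is the Gamma function. Generalized binomial coefficients are defined by $\binom{x}{y}:=\frac{\Gamma(x+1)}{\Gamma(y+1)\Gamma(x-y+1)}$ for real $x\ge y>-1$. For an integer $n>1$ and $\alpha\in[0,1]$, put $c_k=c_{k,n}^\alpha=\binom{n+\alpha}{\alpha}^{-1}\binom{n-k+\alpha}{\alpha}$ for $k=0,\ldots,n$ and $c_k=0$ for $k>n$. The generalized Cesàro operator $\sigma_n^\alpha$ acts on a power series $f(z)=\sum_{k\ge0}a_kz^k$ by $(\sigma_n^\alpha f)(z)=\sum_{k=0}^n c_k a_k z^k$. For a sequence $c=(c_k)_{k\ge1}$ of complex numbers, $T_c$ denotes the infinite upper triangular matrix with entries $(T_c)_{ii}=c_i$, $(T_c)_{ij}=c_j-c_{j-1}$ for $j>i\geq 1$, and $(T_c)_{ij}=0$ for $j<i$. The norm is defined by $\|\sigma_n^\alpha\|:=\|T_c\|_{\ell^2\to\ell^2}$, the operator norm on $\ell^2=\ell^2(\{1,2,\ldots\})$ of $T_c$ for the sequence $c=(c_{k,n}^\alpha)_{k\ge1}$ with $c_{k,n}^\alpha=\binom{n+\alpha}{\alpha}^{-1}\binom{n-k+\alpha}{\alpha}$ for $1\le k\le n$ and $c_{k,n}^\alpha=0$ for $k>n$. Equivalently (known fact), $\|\sigma_n^\alpha\|^2=\sup_f \mathcal{D}_1(\sigma_n^\alpha f)/\mathcal{D}_1(f)$,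 the supremum being over nonconstant $f$ holomorphic on the open unit disc $\mathbb{D}$ with $\mathcal{D}_1(f):=\int_{\mathbb{D}}\frac{1-|z|^2}{|1-z|^2}|f'(z)|^2\,dA(z)<\infty$, where $dA$ is area measure (its normalization does not affect the quotient). The notation $f(n)\sim g(n)$ means $\lim_{n\to\infty} f(n)/g(n)=1$. *)

theory Defs
  imports "HOL-Analysis.Analysis" "HOL-Library.Landau_Symbols"
begin

definition gen_binomial :: "real \<Rightarrow> real \<Rightarrow> real" where
  "gen_binomial x y = Gamma (x + 1) / (Gamma (y + 1) * Gamma (x - y + 1))"

definition cesaro_coeff :: "real \<Rightarrow> nat \<Rightarrow> nat \<Rightarrow> real" where
  "cesaro_coeff \<alpha> n k =
     (if k \<le> n
      then inverse (gen_binomial (real n + \<alpha>) \<alpha>) * gen_binomial (real n - real k + \<alpha>) \<alpha>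
      else 0)"

(* Sequences and matrices are indexed by {1..}; their values at index 0 are never used. *)

definition ell2 :: "(nat \<Rightarrow> complex) set" where
  "ell2 = {x. (\<lambda>k. (cmod (x k))\<^sup>2) summable_on {1..}}"

definition ell2_norm :: "(nat \<Rightarrow> complex) \<Rightarrow> real" where
  "ell2_norm x = sqrt (\<Sum>\<^sub>\<infinity>k\<in>{1..}. (cmod (x k))\<^sup>2)"

definition mat_apply :: "(nat \<Rightarrow> nat \<Rightarrow> complex) \<Rightarrow> (nat \<Rightarrow> complex) \<Rightarrow> nat \<Rightarrow> complex" where
  "mat_apply A x i = (\<Sum>\<^sub>\<infinity>j\<in>{1..}. A i j * x j)"

(* A acts on ell2 as a bounded operator with bound C. Summability of each row against x is
   demanded explicitly, since infsum is 0 on families that are not summable. *)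
definition ell2_bound :: "(nat \<Rightarrow> nat \<Rightarrow> complex) \<Rightarrow> real \<Rightarrow> bool" where
  "ell2_bound A C \<longleftrightarrow> 0 \<le> C \<and>
     (\<forall>x\<in>ell2. (\<forall>i\<ge>1. (\<lambda>j. A i j * x j) summable_on {1..}) \<and>
        mat_apply A x \<in> ell2 \<and> ell2_norm (mat_apply A x) \<le> C * ell2_norm x)"

(* Only meaningful if some bound exists; see ell2_bound_T_mat_cesaro below. *)
definition ell2_opnorm :: "(nat \<Rightarrow> nat \<Rightarrow> complex) \<Rightarrow> real" where
  "ell2_opnorm A = Inf {C. ell2_bound A C}"

definition T_mat :: "(nat \<Rightarrow> complex) \<Rightarrow> nat \<Rightarrow> nat \<Rightarrow> complex" where
  "T_mat c i j = (if j = i then c i else if i < j then c j - c (j - 1) else 0)"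

definition cesaro_norm :: "real \<Rightarrow> nat \<Rightarrow> real" where
  "cesaro_norm \<alpha> n = ell2_opnorm (T_mat (\<lambda>k. complex_of_real (cesaro_coeff \<alpha> n k)))"

lemma ell2_bound_finite_matrix:
  assumes A: "\<And>i j. N < i \<or> N < j \<Longrightarrow> A i j = 0"
  shows "\<exists>C. ell2_bound A C"
proof -
  define R where "R i = (\<Sum>j=1..N. cmod (A i j))" for i
  define C where "C = sqrt (\<Sum>i=1..N. (R i)\<^sup>2)"
  have "(\<forall>i\<ge>1. (\<lambda>j. A i j * x j) summable_on {1..}) \<and>
        mat_apply A x \<in> ell2 \<and> ell2_norm (mat_apply A x) \<le> C * ell2_norm x"
    if x: "x \<in> ell2" for x
  proof -
    have sx: "(\<lambda>k. (cmod (x k))\<^sup>2) summable_on {1..}"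
      using x by (simp add: ell2_def)
    have row: "(\<lambda>j. A i j * x j) summable_on {1..}" for i
      by (rule iffD1[OF summable_on_cong_neutral[of "{1..}" "{1..N}"] summable_on_finite])
         (use A in auto)
    have ap: "mat_apply A x i = (\<Sum>j=1..N. A i j * x j)" for i
      unfolding mat_apply_def
      by (subst infsum_cong_neutral[of "{1..N}" "{1..}" _ "\<lambda>j. A i j * x j"]) (use A in auto)
    have ap0: "mat_apply A x i = 0" if "N < i" for i
      using that A by (simp add: ap)
    have s: "(\<lambda>i. (cmod (mat_apply A x i))\<^sup>2) summable_on {1..}"
      by (rule iffD1[OF summable_on_cong_neutral[of "{1..}" "{1..N}"] summable_on_finite])
         (use ap0 in auto)
    have eq: "(\<Sum>\<^sub>\<infinity>i\<in>{1..}. (cmod (mat_apply A x i))\<^sup>2) = (\<Sum>i=1..N. (cmod (mat_apply A x i))\<^sup>2)"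
      by (subst infsum_cong_neutral[of "{1..N}" "{1..}" _ "\<lambda>i. (cmod (mat_apply A x i))\<^sup>2"])
         (use ap0 in auto)
    have comp: "cmod (x j) \<le> ell2_norm x" if "j \<ge> 1" for j
    proof -
      have "(\<Sum>k\<in>{j}. (cmod (x k))\<^sup>2) \<le> (\<Sum>\<^sub>\<infinity>k\<in>{1..}. (cmod (x k))\<^sup>2)"
        by (rule finite_sum_le_infsum[OF sx]) (use that in auto)
      then show ?thesis
        unfolding ell2_norm_def by (simp add: real_le_rsqrt)
    qed
    have nn: "0 \<le> ell2_norm x"
      unfolding ell2_norm_def by (simp add: infsum_nonneg)
    have "cmod (mat_apply A x i) \<le> R i * ell2_norm x" for i
    proof -
      have "cmod (mat_apply A x i) \<le> (\<Sum>j=1..N. cmod (A i j) * cmod (x j))"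
        unfolding ap by (rule order_trans[OF norm_sum]) (simp add: norm_mult)
      also have "\<dots> \<le> (\<Sum>j=1..N. cmod (A i j) * ell2_norm x)"
        by (intro sum_mono mult_left_mono comp) auto
      finally show ?thesis by (simp add: R_def sum_distrib_right)
    qed
    then have "(\<Sum>i=1..N. (cmod (mat_apply A x i))\<^sup>2) \<le> (\<Sum>i=1..N. (R i * ell2_norm x)\<^sup>2)"
      by (intro sum_mono power_mono) auto
    also have "\<dots> = (\<Sum>i=1..N. (R i)\<^sup>2) * (ell2_norm x)\<^sup>2"
      by (simp add: power_mult_distrib sum_distrib_right)
    finally have "ell2_norm (mat_apply A x) \<le> sqrt ((\<Sum>i=1..N. (R i)\<^sup>2) * (ell2_norm x)\<^sup>2)"
      unfolding ell2_norm_def[of "mat_apply A x"] eq by (rule real_sqrt_le_mono)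
    also have "\<dots> = C * ell2_norm x"
      using nn by (simp add: C_def real_sqrt_mult)
    finally show ?thesis
      using row s by (simp add: ell2_def)
  qed
  moreover have "0 \<le> C" by (simp add: C_def sum_nonneg)
  ultimately show ?thesis unfolding ell2_bound_def by blast
qed

lemma ell2_bound_T_mat_cesaro:
  "\<exists>C. ell2_bound (T_mat (\<lambda>k. complex_of_real (cesaro_coeff \<alpha> n k))) C"
  by (rule ell2_bound_finite_matrix[where N = "Suc n"]) (auto simp: T_mat_def cesaro_coeff_def)

end

theory Submission
  imports Defs "HOL-Real_Asymp.Real_Asymp"
begin

text \<open>
  Write \<open>w\<^sub>m = (1/2)\<^sub>m / m!\<close> and \<open>d\<^sub>j = c\<^sub>j\<^sub>-\<^sub>1 - c\<^sub>j\<close>. For \<open>\<alpha> = 1/2\<close> one has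
  \<open>c\<^sub>k = b\<^sub>n\<^sub>-\<^sub>k / b\<^sub>n\<close> with \<open>b\<^sub>m = (2m+1) w\<^sub>m\<close>, hence \<open>d\<^sub>j = w\<^sub>n\<^sub>+\<^sub>1\<^sub>-\<^sub>j / b\<^sub>n\<close>. As \<open>T\<^sub>c\<close> is
  the diagonal contraction \<open>diag(c)\<close> minus the strictly upper triangular matrix \<open>D\<close> with
  \<open>D\<^sub>i\<^sub>j = d\<^sub>j\<close>, it is enough to estimate \<open>D\<close> up to an additive constant. The Cauchy--Schwarz
  inequality in every row gives \<open>\<parallel>D\<parallel>\<^sup>2 \<le> n \<Sum>\<^sub>j d\<^sub>j\<^sup>2\<close>, which is asymptotic to \<open>(ln n)/4\<close> by
  Wallis' product. Testing \<open>D\<close> on the vector \<open>d\<close> itself shows that this is sharp: the sums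
  \<open>\<Sum>\<^sub>j\<^sub>>\<^sub>i d\<^sub>j\<^sup>2\<close> grow so slowly in \<open>n - i\<close> that almost every row attains nearly the full value.
\<close>

section \<open>Norms of triangular matrices\<close>

lemma ell2_opnorm_le: "ell2_bound A C \<Longrightarrow> ell2_opnorm A \<le> C"
  unfolding ell2_opnorm_def
  by (rule cInf_lower) (auto intro!: bdd_belowI[of _ 0] simp: ell2_bound_def)

lemma ell2_opnorm_ge:
  assumes "\<exists>C. ell2_bound A C" "\<And>C. ell2_bound A C \<Longrightarrow> L \<le> C"
  shows "L \<le> ell2_opnorm A"
  unfolding ell2_opnorm_def by (rule cInf_greatest) (use assms in auto)

lemma ell2_finite_support:
  assumes "\<And>i. i > N \<Longrightarrow> x i = 0"
  shows "x \<in> ell2"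
  unfolding ell2_def mem_Collect_eq
  by (rule iffD1[OF summable_on_cong_neutral[of "{1..}" "{1..N}"] summable_on_finite])
     (use assms in auto)

lemma ell2_norm_finite_support:
  assumes "\<And>i. i > N \<Longrightarrow> x i = 0"
  shows "ell2_norm x = L2_set (\<lambda>i. cmod (x i)) {1..N}"
  unfolding ell2_norm_def L2_set_def
  by (subst infsum_cong_neutral[of "{1..N}" "{1..}" _ "\<lambda>i. (cmod (x i))\<^sup>2"]) (use assms in auto)

lemma L2_set_le_ell2_norm:
  assumes "x \<in> ell2" "finite F" "F \<subseteq> {1..}"
  shows "L2_set (\<lambda>i. cmod (x i)) F \<le> ell2_norm x"
  unfolding ell2_norm_def L2_set_def
  using assms by (intro real_sqrt_le_mono finite_sum_le_infsum) (auto simp: ell2_def)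

lemma ell2_norm_nonneg: "0 \<le> ell2_norm x"
  by (simp add: ell2_norm_def infsum_nonneg)

text \<open>The sum runs to \<open>Suc n\<close>, one past the support of \<open>c\<close>: the
  difference at \<open>j = Suc n\<close> is \<open>c n\<close>, which need not vanish.\<close>

lemma mat_apply_T_mat:
  assumes c: "\<And>k. k > n \<Longrightarrow> c k = 0" and "i \<ge> 1"
  shows "mat_apply (T_mat c) x i = c i * x i - (\<Sum>j=Suc i..Suc n. (c (j - 1) - c j) * x j)"
proof -
  have "mat_apply (T_mat c) x i = (\<Sum>j=i..Suc n. T_mat c i j * x j)"
    unfolding mat_apply_def
    by (subst infsum_cong_neutral[of "{i..Suc n}" "{1..}" _ "\<lambda>j. T_mat c i j * x j"])
       (use assms in \<open>auto simp: T_mat_def\<close>)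
  also have "\<dots> = c i * x i + (\<Sum>j=Suc i..Suc n. T_mat c i j * x j)"
  proof (cases "i \<le> Suc n")
    case True
    then show ?thesis by (subst sum.atLeast_Suc_atMost) (auto simp: T_mat_def)
  qed (use c in auto)
  also have "(\<Sum>j=Suc i..Suc n. T_mat c i j * x j) = (\<Sum>j=Suc i..Suc n. - ((c (j - 1) - c j) * x j))"
    by (intro sum.cong) (auto simp: T_mat_def algebra_simps)
  finally show ?thesis by (simp add: sum_negf)
qed

lemma ell2_bound_T_mat_ex:
  assumes "\<And>k. k > n \<Longrightarrow> c k = 0"
  shows "\<exists>C. ell2_bound (T_mat c) C"
  by (rule ell2_bound_finite_matrix[where N = "Suc n"]) (use assms in \<open>auto simp: T_mat_def\<close>)

text \<open>All rows of the strictly upper part are truncations of one difference vector, so a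
  single Cauchy--Schwarz bound serves them all. The rows beyond \<open>n\<close> vanish, whence the
  factor \<open>n\<close>; the diagonal adds at most 1.\<close>

lemma ell2_opnorm_T_mat_le:
  assumes c: "\<And>k. k > n \<Longrightarrow> c k = 0" and c1: "\<And>k. cmod (c k) \<le> 1"
  shows "ell2_opnorm (T_mat c) \<le> 1 + sqrt (real n * (\<Sum>j=Suc 0..Suc n. (cmod (c (j - 1) - c j))\<^sup>2))"
    (is "_ \<le> 1 + sqrt (real n * ?S)")
proof (rule ell2_opnorm_le)
  have S: "0 \<le> ?S" by (intro sum_nonneg) auto
  \<comment> \<open>Summability of the rows and membership of the image in \<open>ell2\<close> do
    not depend on the constant, so any bound supplies them.\<close>
  obtain C where C: "ell2_bound (T_mat c) C" using ell2_bound_T_mat_ex[of n c] c by blast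
  have T: "mat_apply (T_mat c) x i = c i * x i - (\<Sum>j=Suc i..Suc n. (c (j - 1) - c j) * x j)"
    if "i \<ge> 1" for x i
    by (rule mat_apply_T_mat) (use c that in auto)
  have "ell2_norm (mat_apply (T_mat c) x) \<le> (1 + sqrt (real n * ?S)) * ell2_norm x"
    if x: "x \<in> ell2" for x
  proof -
    let ?D = "\<lambda>i. \<Sum>j=Suc i..Suc n. (c (j - 1) - c j) * x j"
    have row: "cmod (?D i) \<le> sqrt ?S * ell2_norm x" if "i \<ge> 1" for i
    proof -
      have "cmod (?D i) \<le> (\<Sum>j=Suc i..Suc n. \<bar>cmod (c (j - 1) - c j)\<bar> * \<bar>cmod (x j)\<bar>)"
        by (rule order_trans[OF norm_sum]) (simp add: norm_mult)
      also have "\<dots> \<le> (\<Sum>j=Suc 0..Suc n. \<bar>cmod (c (j - 1) - c j)\<bar> * \<bar>cmod (x j)\<bar>)"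
        by (intro sum_mono2) auto
      also have "\<dots> \<le> sqrt ?S * L2_set (\<lambda>j. cmod (x j)) {Suc 0..Suc n}"
        using L2_set_mult_ineq[of "\<lambda>j. cmod (c (j - 1) - c j)" "\<lambda>j. cmod (x j)"]
        by (simp only: L2_set_def)
      also have "\<dots> \<le> sqrt ?S * ell2_norm x"
        using S by (intro mult_left_mono L2_set_le_ell2_norm x) auto
      finally show ?thesis .
    qed
    have "ell2_norm (mat_apply (T_mat c) x) = L2_set (\<lambda>i. cmod (mat_apply (T_mat c) x i)) {1..n}"
      by (rule ell2_norm_finite_support) (use c in \<open>auto simp: T\<close>)
    also have "\<dots> \<le> L2_set (\<lambda>i. cmod (x i) + sqrt ?S * ell2_norm x) {1..n}"
    proof (rule L2_set_mono)
      fix i assume "i \<in> {1..n}"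
      then have i: "i \<ge> 1" by simp
      have "cmod (mat_apply (T_mat c) x i) \<le> cmod (c i * x i) + cmod (?D i)"
        unfolding T[OF i] by (rule norm_triangle_ineq4)
      also have "\<dots> \<le> cmod (x i) + sqrt ?S * ell2_norm x"
        using row[OF i] mult_right_mono[OF c1[of i], of "cmod (x i)"] by (simp add: norm_mult)
      finally show "cmod (mat_apply (T_mat c) x i) \<le> cmod (x i) + sqrt ?S * ell2_norm x" .
    qed simp
    also have "\<dots> \<le> L2_set (\<lambda>i. cmod (x i)) {1..n} + L2_set (\<lambda>i. sqrt ?S * ell2_norm x) {1..n}"
      by (rule L2_set_triangle_ineq)
    also have "\<dots> \<le> ell2_norm x + sqrt n * (sqrt ?S * ell2_norm x)"
      using S by (intro add_mono L2_set_le_ell2_norm x) (auto simp: L2_set_constant ell2_norm_nonneg)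
    finally show ?thesis
      unfolding real_sqrt_mult by (simp add: algebra_simps)
  qed
  then show "ell2_bound (T_mat c) (1 + sqrt (real n * ?S))"
    using C S by (auto simp: ell2_bound_def)
qed

text \<open>On the conjugated difference vector, of norm \<open>sqrt (s 0)\<close>, row
  \<open>i\<close> of the strictly upper part returns exactly \<open>s i\<close>. Cauchy--Schwarz
  against the constant vector 1 then replaces the \<open>L2_set\<close> of \<open>s\<close> by its
  plain sum.\<close>

lemma sum_tails_le_ell2_opnorm_T_mat:
  fixes c :: "nat \<Rightarrow> complex" and n :: nat and s :: "nat \<Rightarrow> real"
  defines "s \<equiv> \<lambda>i. \<Sum>j=Suc i..Suc n. (cmod (c (j - 1) - c j))\<^sup>2"
  assumes c: "\<And>k. k > n \<Longrightarrow> c k = 0" and c1: "\<And>k. cmod (c k) \<le> 1"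
  shows "(\<Sum>i=1..n. s i) \<le> sqrt (n * s 0) * (1 + ell2_opnorm (T_mat c))"
\<comment> \<open>The main case divides by \<open>sqrt (n * s 0)\<close>; when this is 0, both sides
  vanish.\<close>
proof (cases "n * s 0 = 0")
  case True
  have "s i \<le> s 0" "0 \<le> s i" for i
    unfolding s_def by (intro sum_mono2 sum_nonneg; auto)+
  then have "(\<Sum>i=1..n. s i) \<le> (\<Sum>i=1..n. s 0)"
    by (intro sum_mono)
  then show ?thesis using True by auto
next
  case False
  have s_nonneg: "0 \<le> s i" for i unfolding s_def by (intro sum_nonneg) auto
  then have "0 \<le> n * s 0"
    by (intro mult_nonneg_nonneg) auto
  with False have pos: "0 < sqrt (n * s 0)"
    by (intro real_sqrt_gt_zero) linarith
  have "(\<Sum>i=1..n. s i) / sqrt (n * s 0) - 1 \<le> ell2_opnorm (T_mat c)"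
  proof (rule ell2_opnorm_ge)
    show "\<exists>C. ell2_bound (T_mat c) C" using ell2_bound_T_mat_ex[of n c] c by blast
  next
    fix C assume C: "ell2_bound (T_mat c) C"
    define x where "x j = (if j = 0 then 0 else cnj (c (j - 1) - c j))" for j
    let ?y = "mat_apply (T_mat c) x"
    have x0: "x j = 0" if "j > Suc n" for j
      using that c by (simp add: x_def)
    have x: "x \<in> ell2" using ell2_finite_support[of "Suc n" x] x0 by blast
    have nx: "ell2_norm x = sqrt (s 0)"
      using ell2_norm_finite_support[of "Suc n" x] x0
      by (simp only: L2_set_def s_def)
         (auto simp: x_def simp del: complex_cnj_diff intro!: sum.cong)
    have y: "?y i = c i * x i - complex_of_real (s i)" if "i \<ge> 1" for i
    proof -
      have "(\<Sum>j=Suc i..Suc n. (c (j - 1) - c j) * x j) = complex_of_real (s i)"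
        unfolding s_def of_real_sum
        by (intro sum.cong) (auto simp: x_def simp del: complex_cnj_diff simp flip: complex_norm_square)
      then show ?thesis using mat_apply_T_mat[of n c i x] c that by simp
    qed
    \<comment> \<open>Solving for \<open>s i\<close> isolates the diagonal term, which costs at most
      \<open>cmod (x i)\<close> because \<open>cmod (c i)\<close> is at most 1.\<close>
    have "L2_set s {1..n} \<le> L2_set (\<lambda>i. cmod (?y i) + cmod (x i)) {1..n}"
    proof (rule L2_set_mono)
      fix i assume "i \<in> {1..n}"
      then have i: "i \<ge> 1" by simp
      have "s i = cmod (c i * x i - ?y i)"
        using s_nonneg[of i] by (simp add: y[OF i])
      also have "\<dots> \<le> cmod (c i * x i) + cmod (?y i)"
        by (rule norm_triangle_ineq4)
      also have "\<dots> \<le> cmod (?y i) + cmod (x i)"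
        using mult_right_mono[OF c1[of i], of "cmod (x i)"] by (simp add: norm_mult)
      finally show "s i \<le> cmod (?y i) + cmod (x i)" .
    qed (use s_nonneg in auto)
    also have "\<dots> \<le> L2_set (\<lambda>i. cmod (?y i)) {1..n} + L2_set (\<lambda>i. cmod (x i)) {1..n}"
      by (rule L2_set_triangle_ineq)
    also have "\<dots> \<le> ell2_norm ?y + ell2_norm x"
      using C x by (intro add_mono L2_set_le_ell2_norm) (auto simp: ell2_bound_def)
    also have "\<dots> \<le> C * sqrt (s 0) + sqrt (s 0)"
      using C x nx by (auto simp: ell2_bound_def)
    finally have D: "L2_set s {1..n} \<le> C * sqrt (s 0) + sqrt (s 0)" .
    have "(\<Sum>i=1..n. s i) \<le> sqrt n * L2_set s {1..n}"
      using L2_set_mult_ineq[of "\<lambda>i. 1" s "{1..n}"] s_nonneg by (simp add: L2_set_constant)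
    also have "\<dots> \<le> sqrt n * (C * sqrt (s 0) + sqrt (s 0))"
      by (intro mult_left_mono D) auto
    also have "\<dots> = sqrt (n * s 0) * (1 + C)"
      by (simp add: real_sqrt_mult algebra_simps)
    finally show "(\<Sum>i=1..n. s i) / sqrt (n * s 0) - 1 \<le> C"
      using pos by (simp add: field_simps)
  qed
  then show ?thesis using pos by (simp add: field_simps)
qed

section \<open>Wallis coefficients\<close>

text \<open>The Taylor coefficients of \<open>(1 - z)^(-1/2)\<close>, that is
  \<open>(2m choose m) / 4^m\<close>.\<close>

definition wallis_coeff :: "nat \<Rightarrow> real" where
  "wallis_coeff m = pochhammer (1/2) m / fact m"

lemma wallis_coeff_0 [simp]: "wallis_coeff 0 = 1"
  by (simp add: wallis_coeff_def)

lemma wallis_coeff_pos: "wallis_coeff m > 0"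
  by (simp add: wallis_coeff_def pochhammer_pos)

lemma wallis_coeff_Suc:
  "wallis_coeff (Suc m) = wallis_coeff m * (2 * real m + 1) / (2 * (real m + 1))"
  by (simp add: wallis_coeff_def pochhammer_Suc field_simps)

lemma wallis_prod_eq:
  "(\<Prod>k=1..n. (4 * real k ^ 2) / (4 * real k ^ 2 - 1)) = inverse ((2 * real n + 1) * (wallis_coeff n)\<^sup>2)"
proof (induction n)
  case (Suc n)
  let ?f = "\<lambda>k. (4 * real k ^ 2) / (4 * real k ^ 2 - 1)"
  have pos: "2 * real n + 1 > 0" "2 * real n + 3 > 0" "wallis_coeff n > 0"
    by (auto simp: wallis_coeff_pos)
  have "4 * real (Suc n) ^ 2 - 1 = (2 * real n + 1) * (2 * real n + 3)"
    by (simp add: power2_eq_square algebra_simps)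
  then have "(\<Prod>k=1..Suc n. ?f k) = (\<Prod>k=1..n. ?f k) *
      (4 * (real n + 1)\<^sup>2 / ((2 * real n + 1) * (2 * real n + 3)))"
    by (simp add: add.commute)
  also have "\<dots> = inverse ((2 * real n + 3) * (wallis_coeff (Suc n))\<^sup>2)"
    unfolding Suc.IH wallis_coeff_Suc using pos
    by (simp add: power2_eq_square field_simps)
  finally show ?case by (simp add: add.commute)
qed simp

lemma wallis_coeff_limit: "(\<lambda>n. (2 * real n + 1) * (wallis_coeff n)\<^sup>2) \<longlonglongrightarrow> 2 / pi"
  using tendsto_inverse[OF wallis] unfolding wallis_prod_eq by (simp add: divide_simps)

text \<open>The sequence decreases to its Wallis limit: consecutive terms have ratio
  \<open>(2n+1)(2n+3) / (2n+2)^2\<close>, which is below 1.\<close>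

lemma wallis_coeff_lower: "2 / pi \<le> (2 * real n + 1) * (wallis_coeff n)\<^sup>2"
proof (rule decseq_ge[OF decseq_SucI wallis_coeff_limit])
  fix n :: nat
  have "(2 * real n + 3) * (2 * real n + 1) \<le> (2 * (real n + 1))\<^sup>2"
    by (simp add: power2_eq_square algebra_simps)
  then have "((2 * real n + 3) * (2 * real n + 1) / (2 * (real n + 1))\<^sup>2)
               * ((2 * real n + 1) * (wallis_coeff n)\<^sup>2) \<le> 1 * ((2 * real n + 1) * (wallis_coeff n)\<^sup>2)"
    by (intro mult_right_mono) (auto simp: divide_le_eq_1)
  moreover have "(2 * real (Suc n) + 1) * (wallis_coeff (Suc n))\<^sup>2
      = ((2 * real n + 3) * (2 * real n + 1) / (2 * (real n + 1))\<^sup>2)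
               * ((2 * real n + 1) * (wallis_coeff n)\<^sup>2)"
    by (simp add: wallis_coeff_Suc power2_eq_square field_simps)
  ultimately show "(2 * real (Suc n) + 1) * (wallis_coeff (Suc n))\<^sup>2 \<le> (2 * real n + 1) * (wallis_coeff n)\<^sup>2"
    by simp
qed

text \<open>With the factor \<open>n\<close> in place of \<open>2n+1\<close> the sequence increases
  to its limit, because \<open>(2n+1)^2\<close> exceeds \<open>4n(n+1)\<close>.\<close>

lemma wallis_coeff_upper: "real n * (wallis_coeff n)\<^sup>2 \<le> 1 / pi"
proof (rule incseq_le[where X = "\<lambda>n. real n * (wallis_coeff n)\<^sup>2", OF incseq_SucI])
  fix n :: nat
  have "real n \<le> (2 * real n + 1)\<^sup>2 / (4 * (real n + 1))"
    by (simp add: power2_eq_square field_simps)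
  then have "real n * (wallis_coeff n)\<^sup>2 \<le> (2 * real n + 1)\<^sup>2 / (4 * (real n + 1)) * (wallis_coeff n)\<^sup>2"
    by (intro mult_right_mono) auto
  also have "\<dots> = real (Suc n) * (wallis_coeff (Suc n))\<^sup>2"
    by (simp add: wallis_coeff_Suc power2_eq_square divide_simps) (simp add: algebra_simps)
  finally show "real n * (wallis_coeff n)\<^sup>2 \<le> real (Suc n) * (wallis_coeff (Suc n))\<^sup>2" .
next
  have "(\<lambda>n. real n / (2 * real n + 1)) \<longlonglongrightarrow> 1 / 2"
    by real_asymp
  from tendsto_mult[OF this wallis_coeff_limit]
  have "(\<lambda>n. real n / (2 * real n + 1) * ((2 * real n + 1) * (wallis_coeff n)\<^sup>2)) \<longlonglongrightarrow> 1 / pi"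
    by simp
  moreover have "2 * real n + 1 \<noteq> 0" for n by linarith
  ultimately show "(\<lambda>n. real n * (wallis_coeff n)\<^sup>2) \<longlonglongrightarrow> 1 / pi"
    by simp
qed

section \<open>Partial sums of the squared Wallis coefficients\<close>

definition wallis_sum :: "nat \<Rightarrow> real" where
  "wallis_sum n = (\<Sum>m<n. (wallis_coeff m)\<^sup>2)"

lemma wallis_sum_nonneg: "0 \<le> wallis_sum n"
  unfolding wallis_sum_def by (intro sum_nonneg) auto

text \<open>\<open>harm n - ln n\<close> decreases and equals 1 at \<open>n = 1\<close>; the
  sequence in \<open>decseq_harm_diff_ln\<close> is shifted by one, hence the index
  \<open>n - 1\<close>.\<close>

lemma harm_le_ln_plus_1: "n > 0 \<Longrightarrow> harm n \<le> ln (real n) + 1"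
  using decseqD[OF decseq_harm_diff_ln, of 0 "n - 1"] by (simp add: harm_def)

lemma wallis_sum_lower: "ln (real n + 1) / pi \<le> wallis_sum n"
proof -
  have "ln (real n + 1) / pi \<le> harm n / pi"
    by (intro divide_right_mono harm_ge_ln) auto
  also have "harm n / pi = (\<Sum>m<n. 1 / (pi * (real m + 1)))"
    unfolding harm_def sum_divide_distrib
    by (rule sum.reindex_bij_witness[of _ Suc "\<lambda>k. k - 1"]) (auto simp: field_simps)
  also have "\<dots> \<le> wallis_sum n"
    unfolding wallis_sum_def
  proof (rule sum_mono)
    fix m
    \<comment> \<open>Enlarging \<open>2m+1\<close> to \<open>2(m+1)\<close> turns the Wallis lower
      bound into a harmonic term.\<close>
    have "1 / (pi * (real m + 1)) = 2 / pi / (2 * (real m + 1))"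
      by (simp del: distrib_left_numeral)
    also have "\<dots> \<le> 2 / pi / (2 * real m + 1)"
      by (intro divide_left_mono) auto
    also have "\<dots> \<le> (wallis_coeff m)\<^sup>2"
      using wallis_coeff_lower[of m] by (simp add: divide_simps mult_ac)
    finally show "1 / (pi * (real m + 1)) \<le> (wallis_coeff m)\<^sup>2" .
  qed
  finally show ?thesis .
qed

lemma wallis_sum_upper:
  assumes "n > 0"
  shows "wallis_sum (Suc n) \<le> (ln (real n) + 1 + pi) / pi"
proof -
  \<comment> \<open>The term \<open>m = 0\<close> is split off, since
    \<open>wallis_coeff_upper\<close> does not bound it; it accounts for the summand
    \<open>pi\<close> in the numerator.\<close>
  have "wallis_sum (Suc n) = 1 + (\<Sum>m=1..n. (wallis_coeff m)\<^sup>2)"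
    unfolding wallis_sum_def
    by (simp add: lessThan_Suc_atMost atMost_atLeast0 sum.atLeast_Suc_atMost)
  also have "(\<Sum>m=1..n. (wallis_coeff m)\<^sup>2) \<le> (\<Sum>m=1..n. inverse (real m) / pi)"
  proof (rule sum_mono)
    fix m assume "m \<in> {1..n}"
    then show "(wallis_coeff m)\<^sup>2 \<le> inverse (real m) / pi"
      using wallis_coeff_upper[of m] by (simp add: field_simps)
  qed
  also have "\<dots> = harm n / pi"
    by (simp add: harm_def sum_divide_distrib)
  also have "\<dots> \<le> (ln (real n) + 1) / pi"
    using assms by (intro divide_right_mono harm_le_ln_plus_1) auto
  finally show ?thesis by (simp add: add_divide_distrib)
qed

text \<open>Exchange of summation: the square with index \<open>m\<close> occurs in
  \<open>wallis_sum k\<close> for the \<open>n - m\<close> values of \<open>k\<close> from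
  \<open>m + 1\<close> to \<open>n\<close>.\<close>

lemma sum_wallis_sum:
  "(\<Sum>k=1..n. wallis_sum k) = real n * wallis_sum n - (\<Sum>m<n. real m * (wallis_coeff m)\<^sup>2)"
  by (induction n) (auto simp: wallis_sum_def algebra_simps)

text \<open>The slow growth in quantitative form: averaging over \<open>k\<close> loses at most
  \<open>1 / pi\<close> from the last value \<open>wallis_sum n\<close>.\<close>

lemma sum_wallis_sum_ge:
  "real n * (wallis_sum n - 1 / pi) \<le> (\<Sum>k=1..n. wallis_sum k)"
proof -
  have "(\<Sum>m<n. real m * (wallis_coeff m)\<^sup>2) \<le> (\<Sum>m<n. 1 / pi)"
    by (intro sum_mono wallis_coeff_upper)
  then show ?thesis unfolding sum_wallis_sum by (simp add: algebra_simps)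
qed

section \<open>The coefficients for exponent one half\<close>

text \<open>One step of the functional equation at \<open>m + 3/2\<close> and at \<open>3/2\<close>
  produces the factor \<open>2m+1\<close>; the common \<open>Gamma (1/2)\<close> cancels.\<close>

lemma gen_binomial_half:
  "gen_binomial (real m + 1/2) (1/2) = (2 * real m + 1) * wallis_coeff m"
proof -
  have G: "Gamma (real m + 3/2) = (real m + 1/2) * Gamma (real m + 1/2)"
    using Gamma_plus1[of "real m + 1/2"] by (fastforce simp: add_ac dest: nonpos_Ints_nonpos)
  have G0: "Gamma (3/2 :: real) = 1/2 * Gamma (1/2)"
    using Gamma_plus1[of "1/2 :: real"] by (fastforce dest: nonpos_Ints_nonpos)
  have g: "Gamma (1/2 :: real) \<noteq> 0"
    by (simp add: Gamma_one_half_real)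
  then have G1: "Gamma (real m + 1/2) = pochhammer (1/2) m * Gamma (1/2)"
    by (subst pochhammer_Gamma) (auto simp: add_ac)
  have "gen_binomial (real m + 1/2) (1/2) = Gamma (real m + 3/2) / (Gamma (3/2) * Gamma (1 + real m))"
    by (simp add: gen_binomial_def add_ac)
  also have "\<dots> = (2 * real m + 1) * wallis_coeff m"
    unfolding G G0 G1 Gamma_fact wallis_coeff_def using g by (simp add: field_simps)
  finally show ?thesis .
qed

lemma cesaro_coeff_half:
  assumes "k \<le> n"
  shows "cesaro_coeff (1/2) n k =
    (2 * real (n - k) + 1) * wallis_coeff (n - k) / ((2 * real n + 1) * wallis_coeff n)"
proof -
  have "real n - real k = real (n - k)"
    using assms by simp
  then show ?thesis
    using assms by (simp only: cesaro_coeff_def gen_binomial_half if_True) (simp add: field_simps)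
qed

text \<open>The numerators \<open>(2m+1) w_m\<close> are the coefficients of
  \<open>(1 - z)^(-3/2)\<close>; differencing multiplies by \<open>1 - z\<close> and leaves those of
  \<open>(1 - z)^(-1/2)\<close>.\<close>

lemma cesaro_coeff_half_diff:
  assumes "1 \<le> j" "j \<le> Suc n"
  shows "cesaro_coeff (1/2) n (j - 1) - cesaro_coeff (1/2) n j =
    wallis_coeff (Suc n - j) / ((2 * real n + 1) * wallis_coeff n)"
\<comment> \<open>At the drop to zero past the support, the formula persists because the last
  coefficient is 1 divided by the normalization and \<open>wallis_coeff 0 = 1\<close>.\<close>
proof (cases "j = Suc n")
  case True
  then show ?thesis by (simp add: cesaro_coeff_half) (simp add: cesaro_coeff_def)
next
  case False
  define m where "m = n - j"
  have "n - (j - 1) = Suc m" "Suc n - j = Suc m" "n - j = m"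
    using False assms by (auto simp: m_def)
  moreover have "(2 * real (Suc m) + 1) * wallis_coeff (Suc m) - (2 * real m + 1) * wallis_coeff m
      = wallis_coeff (Suc m)"
    by (simp add: wallis_coeff_Suc divide_simps) (simp add: algebra_simps)
  ultimately show ?thesis
    using False assms by (simp add: cesaro_coeff_half flip: diff_divide_distrib)
qed

lemma cesaro_coeff_eq_0: "k > n \<Longrightarrow> cesaro_coeff \<alpha> n k = 0"
  by (simp add: cesaro_coeff_def)

lemma cesaro_coeff_half_bounds: "0 \<le> cesaro_coeff (1/2) n k" "cesaro_coeff (1/2) n k \<le> 1"
proof -
  have denom: "(2 * real n + 1) * wallis_coeff n > 0" for n
    using wallis_coeff_pos[of n] by simp
  show "0 \<le> cesaro_coeff (1/2) n k"
  proof (cases "k \<le> n")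
    case True
    then show ?thesis
      using denom[of n] denom[of "n - k"] by (simp only: cesaro_coeff_half) simp
  qed (simp add: cesaro_coeff_def)
  show "cesaro_coeff (1/2) n k \<le> 1"
  \<comment> \<open>The coefficients start at 1 and decrease, as their differences are
    nonnegative.\<close>
  proof (induction k)
    case 0
    then show ?case using denom[of n] by (simp add: cesaro_coeff_half)
  next
    case (Suc k)
    show ?case
    proof (cases "Suc k \<le> Suc n")
      case True
      have "0 \<le> wallis_coeff (Suc n - Suc k) / ((2 * real n + 1) * wallis_coeff n)"
        using denom[of n] wallis_coeff_pos[of "Suc n - Suc k"] by (intro divide_nonneg_nonneg) auto
      then show ?thesis
        using cesaro_coeff_half_diff[of "Suc k" n] True Suc by simp
    qed (simp add: cesaro_coeff_def)
  qed
qed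

lemma sum_cesaro_coeff_half_diff:
  assumes "i \<le> n"
  shows "(\<Sum>j=Suc i..Suc n. (cmod (complex_of_real (cesaro_coeff (1/2) n (j - 1))
      - complex_of_real (cesaro_coeff (1/2) n j)))\<^sup>2)
    = wallis_sum (Suc n - i) / ((2 * real n + 1) * wallis_coeff n)\<^sup>2"
proof -
  have "(\<Sum>j=Suc i..Suc n. (cmod (complex_of_real (cesaro_coeff (1/2) n (j - 1))
      - complex_of_real (cesaro_coeff (1/2) n j)))\<^sup>2)
    = (\<Sum>j=Suc i..Suc n. (wallis_coeff (Suc n - j))\<^sup>2 / ((2 * real n + 1) * wallis_coeff n)\<^sup>2)"
  proof (intro sum.cong refl)
    fix j assume "j \<in> {Suc i..Suc n}"
    then have j: "1 \<le> j" "j \<le> Suc n" by auto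
    show "(cmod (complex_of_real (cesaro_coeff (1/2) n (j - 1))
        - complex_of_real (cesaro_coeff (1/2) n j)))\<^sup>2
      = (wallis_coeff (Suc n - j))\<^sup>2 / ((2 * real n + 1) * wallis_coeff n)\<^sup>2"
      unfolding of_real_diff[symmetric] norm_of_real power2_abs cesaro_coeff_half_diff[OF j]
      by (rule power_divide)
  qed
  also have "\<dots> = (\<Sum>j=Suc i..Suc n. (wallis_coeff (Suc n - j))\<^sup>2) / ((2 * real n + 1) * wallis_coeff n)\<^sup>2"
    by (rule sum_divide_distrib[symmetric])
  also have "(\<Sum>j=Suc i..Suc n. (wallis_coeff (Suc n - j))\<^sup>2) = wallis_sum (Suc n - i)"
    unfolding wallis_sum_def
    by (rule sum.reindex_bij_witness[of _ "\<lambda>m. Suc n - m" "\<lambda>j. Suc n - j"]) (use assms in auto)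
  finally show ?thesis .
qed

section \<open>Explicit bounds for the norm and the asymptotic formula\<close>

lemma cesaro_norm_half_le:
  assumes "n > 0"
  shows "cesaro_norm (1/2) n \<le> 1 + sqrt (ln (real n) + 1 + pi) / 2"
proof -
  let ?b = "(2 * real n + 1) * wallis_coeff n"
  have "cesaro_norm (1/2) n \<le> 1 + sqrt (n * (wallis_sum (Suc n) / ?b\<^sup>2))"
    using ell2_opnorm_T_mat_le[of n "\<lambda>k. complex_of_real (cesaro_coeff (1/2) n k)"]
      cesaro_coeff_half_bounds cesaro_coeff_eq_0
    unfolding cesaro_norm_def sum_cesaro_coeff_half_diff[OF le0] by simp
  also have "n * (wallis_sum (Suc n) / ?b\<^sup>2) = n / ?b\<^sup>2 * wallis_sum (Suc n)"
    by simp
  \<comment> \<open>By Wallis, \<open>?b\<^sup>2\<close> is at least \<open>4n / pi\<close>. The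
    \<open>pi\<close> then cancels against the one in \<open>wallis_sum_upper\<close>, and 1/4
    leaves the root as 1/2.\<close>
  also have "\<dots> \<le> pi / 4 * ((ln (real n) + 1 + pi) / pi)"
  proof (intro mult_mono wallis_sum_upper assms)
    have "(2 * real n) * (2 / pi) \<le> (2 * real n + 1) * ((2 * real n + 1) * (wallis_coeff n)\<^sup>2)"
      by (intro mult_mono wallis_coeff_lower) auto
    also have "\<dots> = ?b\<^sup>2" by (simp add: power2_eq_square)
    finally have "n \<le> pi / 4 * ?b\<^sup>2" by (simp add: field_simps)
    moreover have "?b\<^sup>2 > 0" using wallis_coeff_pos[of n] by simp
    ultimately show "n / ?b\<^sup>2 \<le> pi / 4" by (simp only: pos_divide_le_eq)
  qed (auto simp: wallis_sum_nonneg)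
  finally show ?thesis by (simp add: real_sqrt_divide)
qed

lemma cesaro_norm_half_ge:
  assumes "n > 0" "ln (real n) \<ge> 1"
  shows "real n / (2 * real n + 1) * (ln (real n) - 1) / sqrt (ln (real n) + 1 + pi) - 1 \<le> cesaro_norm (1/2) n"
proof -
  let ?b = "(2 * real n + 1) * wallis_coeff n" and ?W = "wallis_sum (Suc n)"
  have b: "?b > 0" using wallis_coeff_pos[of n] by simp
  have W: "?W > 0"
    unfolding wallis_sum_def by (intro sum_pos zero_less_power wallis_coeff_pos) auto
  define s where "s i = (\<Sum>j=Suc i..Suc n. (cmod (complex_of_real (cesaro_coeff (1/2) n (j - 1))
      - complex_of_real (cesaro_coeff (1/2) n j)))\<^sup>2)" for i
  have s: "s i = wallis_sum (Suc n - i) / ?b\<^sup>2" if "i \<le> n" for i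
    unfolding s_def by (rule sum_cesaro_coeff_half_diff[OF that])
  have "(\<Sum>i=1..n. s i) \<le> sqrt (n * s 0) * (1 + cesaro_norm (1/2) n)"
    unfolding s_def cesaro_norm_def
    by (rule sum_tails_le_ell2_opnorm_T_mat) (auto simp: cesaro_coeff_half_bounds cesaro_coeff_eq_0)
  also have "(\<Sum>i=1..n. s i) = (\<Sum>i=1..n. wallis_sum (Suc n - i) / ?b\<^sup>2)"
    by (intro sum.cong s) auto
  also have "s 0 = ?W / ?b\<^sup>2"
    using s[of 0] by simp
  also have "(\<Sum>i=1..n. wallis_sum (Suc n - i) / ?b\<^sup>2) = (\<Sum>k=1..n. wallis_sum k) / ?b\<^sup>2"
    unfolding sum_divide_distrib
    by (rule sum.reindex_bij_witness[of _ "\<lambda>k. Suc n - k" "\<lambda>i. Suc n - i"]) auto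
  also have "sqrt (n * (?W / ?b\<^sup>2)) = sqrt n * sqrt ?W / ?b"
    using b by (simp add: real_sqrt_mult real_sqrt_divide)
  finally have *: "(\<Sum>k=1..n. wallis_sum k) / ?b\<^sup>2 * ?b
      \<le> sqrt n * sqrt ?W / ?b * (1 + cesaro_norm (1/2) n) * ?b"
    using b by (intro mult_right_mono) auto
  \<comment> \<open>One factor \<open>?b\<close> cancels between the two sides; the other stays and
    is controlled by the upper bound on \<open>wallis_coeff n\<close>.\<close>
  have cancel: "x / d\<^sup>2 * d = x / d" "y / d * z * d = z * y" if "d > 0" for d x y z :: real
    using that by (simp_all add: power2_eq_square)
  have "(\<Sum>k=1..n. wallis_sum k) / ?b \<le> (1 + cesaro_norm (1/2) n) * (sqrt n * sqrt ?W)"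
    using * unfolding cancel[OF b] .
  then have "(\<Sum>k=1..n. wallis_sum k) / ?b / (sqrt n * sqrt ?W) \<le> 1 + cesaro_norm (1/2) n"
    using W assms by (subst pos_divide_le_eq) auto
  then have *: "(\<Sum>k=1..n. wallis_sum k) / (?b * sqrt n * sqrt ?W) \<le> 1 + cesaro_norm (1/2) n"
    by (simp only: divide_divide_eq_left mult.assoc)
  have "wallis_coeff n \<le> sqrt (1 / (pi * n))"
    using wallis_coeff_upper[of n] assms by (intro real_le_rsqrt) (simp add: field_simps)
  then have w: "wallis_coeff n * sqrt n \<le> 1 / sqrt pi"
    using assms by (simp add: real_sqrt_divide real_sqrt_mult field_simps)
  \<comment> \<open>A factor \<open>1 / pi\<close> is inserted above and below, split as two roots
    below, so that numerator, Wallis factor and \<open>sqrt ?W\<close> can be compared one by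
    one.\<close>
  have "real n / (2 * real n + 1) * (ln (real n) - 1) / sqrt (ln (real n) + 1 + pi)
    = real n * ((ln (real n) - 1) / pi)
      / ((2 * real n + 1) * (1 / sqrt pi) * sqrt ((ln (real n) + 1 + pi) / pi))"
    by (simp add: real_sqrt_divide)
  also have "\<dots> \<le> (\<Sum>k=1..n. wallis_sum k)
      / ((2 * real n + 1) * (wallis_coeff n * sqrt n) * sqrt ?W)"
  proof (intro frac_le mult_mono mult_left_mono w real_sqrt_le_mono wallis_sum_upper assms)
    have "ln (real n) / pi \<le> ln (real n + 1) / pi"
      using assms by (intro divide_right_mono) auto
    then have "(ln (real n) - 1) / pi \<le> wallis_sum n - 1 / pi"
      using wallis_sum_lower[of n] by (simp add: diff_divide_distrib)
    then have "real n * ((ln (real n) - 1) / pi) \<le> real n * (wallis_sum n - 1 / pi)"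
      by (intro mult_left_mono) auto
    also note sum_wallis_sum_ge
    finally show "real n * ((ln (real n) - 1) / pi) \<le> (\<Sum>k=1..n. wallis_sum k)" .
  qed (use assms W wallis_coeff_pos[of n] in
        \<open>auto intro!: sum_nonneg mult_pos_pos simp: wallis_sum_def\<close>)
  also have "\<dots> \<le> 1 + cesaro_norm (1/2) n"
    using * by (simp only: mult.assoc)
  finally show ?thesis by simp
qed

theorem theorem3p2:
  shows "(\<lambda>n::nat. cesaro_norm (1/2) n) \<sim>[sequentially] (\<lambda>n. 1/2 * sqrt (ln (real n)))"
proof (rule asymp_equiv_sandwich_real)
  \<comment> \<open>The quotient \<open>n / (2n+1)\<close> supplies the constant 1/2; the additive
    constants are negligible against \<open>sqrt (ln n)\<close>.\<close>
  show "(\<lambda>n. real n / (2 * real n + 1) * (ln (real n) - 1) / sqrt (ln (real n) + 1 + pi) - 1) \<sim>[sequentially] (\<lambda>n. 1/2 * sqrt (ln (real n)))"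
    by (rule asymp_equivI') real_asymp
  show "(\<lambda>n. 1 + sqrt (ln (real n) + 1 + pi) / 2)
      \<sim>[sequentially] (\<lambda>n. 1/2 * sqrt (ln (real n)))"
    by (rule asymp_equivI') real_asymp
  have "eventually (\<lambda>n. ln (real n) \<ge> 1) sequentially"
    by real_asymp
  then show "eventually (\<lambda>n. cesaro_norm (1/2) n
      \<in> {real n / (2 * real n + 1) * (ln (real n) - 1) / sqrt (ln (real n) + 1 + pi) - 1
        ..1 + sqrt (ln (real n) + 1 + pi) / 2}) sequentially"
    using eventually_gt_at_top[of 0]
    by eventually_elim (use cesaro_norm_half_le cesaro_norm_half_ge in auto)
qed

end
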